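(* Let $\overline{G}$ be a geometric graph with underlying abstract graph $G$, in which any two distinct crossings are independent. Let $n$ be an integer such that there exists a graph homomorphism $\alpha: G \to K_n$ under which no two edges that cross each other in $\overline{G}$ are mapped to the same edge of $K_n$. Then $X(\overline{G}) \leq 2n$.
   Context: Graphs are finite and simple. A geometric graph $\overline{G}$ is a simple graph $G$ drawn in the plane with vertices at distinct points in general position (no three collinear) and edges drawn as straight line segments. Two edges with no common endpoint cross if their segments intersect; a crossing of $\overline{G}$ is a pair of edges that cross, and the vertices of a crossing are the four endpoints of its two edges. Two crossings are independent if they have no vertices in common (equivalently, the minimum graph distance between a vertex of one and a vertex of the other is at least $1$). A geometric homomorphism $f:\overline{G}\to\overline{H}$ between geometric graphs is a map of vertex sets that sends adjacent vertices to adjacent vertices and sends each pair of crossing edges of $\overline{G}$ to a pair of crossing edges of $\overline{H}$. A geometric $n$-clique $\overline{K}_n$ is any geometric graph whose underlying abstract graph is the complete graph $K_n$. The geochromatic number $X(\overline{G})$ is the smallest positive integer $n$ such that there is a geometric homomorphism $\overline{G}\to\overline{K}_n$ for some geometric $n$-clique $\overline{K}_n$. *)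

theory Defs
  imports "HOL-Analysis.Analysis"
begin

record 'a graph =
  verts :: "'a set"
  edges :: "'a set set"

definition simple_graph :: "('a, 'x) graph_scheme \<Rightarrow> bool" where
  "simple_graph G \<longleftrightarrow> finite (verts G) \<and> (\<forall>e\<in>edges G. e \<subseteq> verts G \<and> card e = 2)"

definition all_pairs :: "'a set \<Rightarrow> 'a set set" where
  "all_pairs V = {e. e \<subseteq> V \<and> card e = 2}"

definition complete_graph :: "nat \<Rightarrow> nat graph" where
  "complete_graph n = \<lparr>verts = {..<n}, edges = all_pairs {..<n}\<rparr>"

definition graph_hom ::
    "('a, 'x) graph_scheme \<Rightarrow> ('b, 'y) graph_scheme \<Rightarrow> ('a \<Rightarrow> 'b) \<Rightarrow> bool" where
  "graph_hom G H f \<longleftrightarrow> f \<in> verts G \<rightarrow> verts H \<and>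
     (\<forall>u v. {u, v} \<in> edges G \<longrightarrow> {f u, f v} \<in> edges H)"

text \<open>A drawing is determined by the positions of the vertices. Since a geometric graph extends
  the record of its underlying abstract graph, purely graph-theoretic notions apply to it directly.\<close>

record 'a geo_graph = "'a graph" +
  pos :: "'a \<Rightarrow> real^2"

definition geometric_graph :: "'a geo_graph \<Rightarrow> bool" where
  "geometric_graph G \<longleftrightarrow> simple_graph G \<and> inj_on (pos G) (verts G) \<and>
     (\<forall>u\<in>verts G. \<forall>v\<in>verts G. \<forall>w\<in>verts G.
        u \<noteq> v \<and> u \<noteq> w \<and> v \<noteq> w \<longrightarrow> \<not> collinear {pos G u, pos G v, pos G w})"

text \<open>For an edge \<open>e = {u, v}\<close>, the convex hull is the closed segment between the positions
  of \<open>u\<close> and \<open>v\<close>; see \<open>segment_of_doubleton\<close> below.\<close>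

definition segment_of :: "'a geo_graph \<Rightarrow> 'a set \<Rightarrow> (real^2) set" where
  "segment_of G e = convex hull (pos G ` e)"

lemma segment_of_doubleton: "segment_of G {u, v} = closed_segment (pos G u) (pos G v)"
  by (simp add: segment_of_def segment_convex_hull)

definition edges_cross :: "'a geo_graph \<Rightarrow> 'a set \<Rightarrow> 'a set \<Rightarrow> bool" where
  "edges_cross G e e' \<longleftrightarrow> e \<in> edges G \<and> e' \<in> edges G \<and> e \<inter> e' = {} \<and>
     segment_of G e \<inter> segment_of G e' \<noteq> {}"

text \<open>A crossing is an unordered pair of edges, so its vertices form the set \<open>\<Union>c\<close>.\<close>

definition crossings :: "'a geo_graph \<Rightarrow> 'a set set set" where
  "crossings G = {{e, e'} | e e'. edges_cross G e e'}"

definition independent_crossings :: "'a set set \<Rightarrow> 'a set set \<Rightarrow> bool" where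
  "independent_crossings c d \<longleftrightarrow> \<Union>c \<inter> \<Union>d = {}"

definition geometric_hom :: "'a geo_graph \<Rightarrow> 'b geo_graph \<Rightarrow> ('a \<Rightarrow> 'b) \<Rightarrow> bool" where
  "geometric_hom G H f \<longleftrightarrow> graph_hom G H f \<and>
     (\<forall>e e'. edges_cross G e e' \<longrightarrow> edges_cross H (f ` e) (f ` e'))"

definition geometric_clique :: "nat \<Rightarrow> 'a geo_graph \<Rightarrow> bool" where
  "geometric_clique n K \<longleftrightarrow> geometric_graph K \<and> card (verts K) = n \<and>
     edges K = all_pairs (verts K)"

text \<open>Target cliques have natural numbers as vertices: up to renaming of vertices this covers all
  finite geometric cliques.\<close>

definition geochromatic_number :: "'a geo_graph \<Rightarrow> nat" where
  "geochromatic_number G =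
     (LEAST n. n > 0 \<and> (\<exists>(K :: nat geo_graph) f. geometric_clique n K \<and> geometric_hom G K f))"

text \<open>The minimum is taken over a nonempty set: every geometric graph maps to the clique on its own
  points (or to a single point if it has no vertices).\<close>

lemma geochromatic_number_set_nonempty:
  fixes G :: "'a geo_graph"
  assumes "geometric_graph G"
  shows "\<exists>n>0. \<exists>(K :: nat geo_graph) f. geometric_clique n K \<and> geometric_hom G K f"
proof (cases "verts G = {}")
  case True
  with assms have no_edges: "edges G = {}"
    by (force simp: geometric_graph_def simple_graph_def)
  define K :: "nat geo_graph" where "K = \<lparr>verts = {0}, edges = all_pairs {0}, pos = (\<lambda>_. 0)\<rparr>"
  have "geometric_clique 1 K"
    by (auto simp: geometric_clique_def geometric_graph_def simple_graph_def K_def all_pairs_def)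
  moreover have "geometric_hom G K (\<lambda>_. 0)"
    using True no_edges by (auto simp: geometric_hom_def graph_hom_def edges_cross_def)
  ultimately show ?thesis by (intro exI[of _ 1]) auto
next
  case False
  let ?V = "verts G"
  have fin: "finite ?V" and inj: "inj_on (pos G) ?V"
    and gp: "\<And>u v w. \<lbrakk>u \<in> ?V; v \<in> ?V; w \<in> ?V; u \<noteq> v; u \<noteq> w; v \<noteq> w\<rbrakk>
      \<Longrightarrow> \<not> collinear {pos G u, pos G v, pos G w}"
    and E: "\<And>e. e \<in> edges G \<Longrightarrow> e \<subseteq> ?V \<and> card e = 2"
    using assms by (auto simp: geometric_graph_def simple_graph_def)
  obtain f where f: "bij_betw f ?V {0..<card ?V}"
    using ex_bij_betw_finite_nat[OF fin] by blast
  define g where "g = inv_into ?V f"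
  have gf: "g (f x) = x" if "x \<in> ?V" for x
    using f that by (simp add: g_def bij_betw_inv_into_left)
  have g: "bij_betw g {0..<card ?V} ?V"
    unfolding g_def by (rule bij_betw_inv_into[OF f])
  have gV: "g i \<in> ?V" if "i < card ?V" for i
    using g that by (auto dest: bij_betwE)
  have ginj: "g i = g j \<longleftrightarrow> i = j" if "i < card ?V" "j < card ?V" for i j
    using g that by (auto simp: bij_betw_def inj_on_def)
  define K :: "nat geo_graph" where
    "K = \<lparr>verts = {0..<card ?V}, edges = all_pairs {0..<card ?V}, pos = pos G \<circ> g\<rparr>"
  have inj': "inj_on (pos G \<circ> g) {0..<card ?V}"
    using g inj by (auto simp: bij_betw_def intro!: comp_inj_on)
  have clique: "geometric_clique (card ?V) K"
    unfolding geometric_clique_def geometric_graph_def simple_graph_def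
    using inj' gV gp ginj by (auto simp: K_def all_pairs_def)
  have pairs: "f ` e \<in> edges K" if "e \<in> edges G" for e
  proof -
    have "inj_on f e"
      using E[OF that] f by (auto simp: bij_betw_def intro: inj_on_subset)
    then have "card (f ` e) = 2" using E[OF that] by (simp add: card_image)
    moreover have "f ` e \<subseteq> {0..<card ?V}"
      using E[OF that] f by (auto simp: bij_betw_def)
    ultimately show ?thesis by (simp add: K_def all_pairs_def)
  qed
  have seg: "segment_of K (f ` e) = segment_of G e" if "e \<in> edges G" for e
  proof -
    have "pos K ` f ` e = pos G ` e"
      unfolding image_image using E[OF that] gf by (intro image_cong) (auto simp: K_def)
    then show ?thesis by (simp add: segment_of_def)
  qed
  have "geometric_hom G K f"
    unfolding geometric_hom_def graph_hom_def
  proof (intro conjI allI impI)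
    show "f \<in> ?V \<rightarrow> verts K" using f by (auto simp: K_def bij_betw_def)
    show "{f u, f v} \<in> edges K" if "{u, v} \<in> edges G" for u v
      using pairs[OF that] by simp
    show "edges_cross K (f ` e) (f ` e')" if "edges_cross G e e'" for e e'
    proof -
      have ee: "e \<in> edges G" "e' \<in> edges G" "e \<inter> e' = {}"
        using that by (auto simp: edges_cross_def)
      then have "f ` e \<inter> f ` e' = {}"
        using E[of e] E[of e'] f inj_on_image_Int[of f ?V e e'] by (auto simp: bij_betw_def)
      then show ?thesis using that ee pairs seg by (auto simp: edges_cross_def)
    qed
  qed
  moreover have "card ?V > 0" using False fin by (simp add: card_gt_0_iff)
  ultimately show ?thesis using clique by blast
qed

end

theory Submission
  imports Defs
begin

text \<open>The target is the clique on the \<open>2 * n\<close> points \<open>(k, k\<^sup>2)\<close>, \<open>k < 2 * n\<close>, of a parabola. These are in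
  convex position, so two chords cross as soon as their endpoints interleave along the parabola,
  and crossing becomes a statement about the order of natural numbers
  (\<open>parabola_chords_meet\<close>).

  Each colour \<open>i < n\<close> owns the two points \<open>i\<close> and \<open>i + n\<close>. A vertex of colour \<open>i\<close> is sent to one of
  them, so adjacent vertices automatically get distinct images, and only the crossings constrain
  the choice. Since the two halves of the parabola list the colours in the same order, the
  endpoints of any two edges with different colour pairs can be lifted so that they interleave
  (\<open>interleaved_lift\<close>); this covers the case of one shared colour, where the shared colour uses
  both of its points. Different crossings have no common vertex, so the choices made for the
  individual crossings fit together to one map.\<close>

definition parabola :: "real \<Rightarrow> real^2" where
  "parabola t = vector [t, t\<^sup>2]"

lemma parabola_nth [simp]: "parabola t $ 1 = t" "parabola t $ 2 = t\<^sup>2"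
  by (simp_all add: parabola_def)

lemma inj_parabola: "inj parabola"
  by (metis injI parabola_nth(1))

lemma parabola_not_collinear:
  assumes "a \<noteq> b" "a \<noteq> c" "b \<noteq> c"
  shows "\<not> collinear {parabola a, parabola b, parabola c}"
proof
  assume "collinear {parabola a, parabola b, parabola c}"
  then have "collinear {0, parabola a - parabola b, parabola c - parabola b}"
    using collinear_3[of "parabola a" "parabola b" "parabola c"] unfolding NO_MATCH_def by blast
  moreover have "parabola a \<noteq> parabola b" "parabola c \<noteq> parabola b"
    using assms injD[OF inj_parabola] by blast+
  ultimately obtain k where k: "parabola c - parabola b = k *\<^sub>R (parabola a - parabola b)"
    by (auto simp: collinear_lemma)
  have "c - b = k * (a - b)" "c\<^sup>2 - b\<^sup>2 = k * (a\<^sup>2 - b\<^sup>2)"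
    using arg_cong[OF k, of "\<lambda>v. v $ 1"] arg_cong[OF k, of "\<lambda>v. v $ 2"] by simp_all
  then have "(c - b) * (c - a) = 0" by algebra
  with assms show False by simp
qed

text \<open>The line through \<open>parabola a\<close> and \<open>parabola b\<close> is \<open>Y = (a + b) * X - a * b\<close>.\<close>

lemma in_parabola_chord:
  assumes "a < b" "a \<le> X" "X \<le> b"
  shows "vector [X, (a + b) * X - a * b] \<in> closed_segment (parabola a) (parabola b)"
proof -
  define t where "t = (X - a) / (b - a)"
  have t: "0 \<le> t" "t \<le> 1" and "t * (b - a) = X - a"
    using assms by (simp_all add: t_def)
  then have X: "X = (1 - t) * a + t * b" by (simp add: algebra_simps)
  have "vector [X, (a + b) * X - a * b] = (1 - t) *\<^sub>R parabola a + t *\<^sub>R parabola b"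
    by (simp add: vec_eq_iff forall_2 X power2_eq_square algebra_simps)
  with t show ?thesis by (auto simp: in_segment)
qed

lemma parabola_chords_meet:
  assumes "w < x" "x < y" "y < z"
  shows "closed_segment (parabola w) (parabola y) \<inter> closed_segment (parabola x) (parabola z) \<noteq> {}"
proof -
  \<comment> \<open>\<open>X\<close> is the first coordinate of the common point of the two lines.\<close>
  define D where "D = x + z - w - y"
  define X where "X = (x * z - w * y) / D"
  have D: "D > 0" using assms by (simp add: D_def)
  have XD: "X * D = x * z - w * y" using D by (simp add: X_def)
  have "(X - x) * D = (y - x) * (x - w)" "(y - X) * D = (y - x) * (z - y)"
    using XD unfolding D_def by algebra+
  then have "(X - x) * D \<ge> 0" "(y - X) * D \<ge> 0" using assms by simp_all
  then have X: "x \<le> X" "X \<le> y" using D by (simp_all add: zero_le_mult_iff)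
  have "(w + y) * X - w * y = (x + z) * X - x * z"
    using XD unfolding D_def by algebra
  moreover have "vector [X, (w + y) * X - w * y] \<in> closed_segment (parabola w) (parabola y)"
    "vector [X, (x + z) * X - x * z] \<in> closed_segment (parabola x) (parabola z)"
    using X assms by (auto intro!: in_parabola_chord)
  ultimately show ?thesis by auto
qed

definition interleaved :: "'a :: linorder set \<Rightarrow> 'a set \<Rightarrow> bool" where
  "interleaved A B \<longleftrightarrow> (\<exists>w x y z. w < x \<and> x < y \<and> y < z \<and>
     (A = {w, y} \<and> B = {x, z} \<or> A = {x, z} \<and> B = {w, y}))"

lemma interleaved_sym: "interleaved A B \<Longrightarrow> interleaved B A"
  unfolding interleaved_def by blast

lemma interleavedI: "w < x \<Longrightarrow> x < y \<Longrightarrow> y < z \<Longrightarrow> interleaved {w, y} {x, z}"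
  unfolding interleaved_def by blast

definition parabola_clique :: "nat \<Rightarrow> nat geo_graph" where
  "parabola_clique m = \<lparr>verts = {..<m}, edges = all_pairs {..<m}, pos = (\<lambda>k. parabola (real k))\<rparr>"

lemma geometric_clique_parabola_clique: "geometric_clique m (parabola_clique m)"
  unfolding geometric_clique_def geometric_graph_def simple_graph_def
  by (auto simp: parabola_clique_def all_pairs_def inj_on_def parabola_not_collinear
      inj_eq[OF inj_parabola])

lemma edges_cross_parabola_clique:
  assumes "interleaved A B" "A \<subseteq> {..<m}" "B \<subseteq> {..<m}"
  shows "edges_cross (parabola_clique m) A B"
proof -
  obtain w x y z where o: "w < x" "x < y" "y < z"
    and AB: "A = {w, y} \<and> B = {x, z} \<or> A = {x, z} \<and> B = {w, y}"
    using assms(1) unfolding interleaved_def by blast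
  have "segment_of (parabola_clique m) {w, y} \<inter> segment_of (parabola_clique m) {x, z} \<noteq> {}"
    unfolding segment_of_doubleton using o parabola_chords_meet[of w x y z]
    by (simp add: parabola_clique_def)
  then show ?thesis
    using AB o assms(2,3) by (auto simp: edges_cross_def parabola_clique_def all_pairs_def)
qed

lemma card_2_image_ordered:
  fixes \<alpha> :: "'a \<Rightarrow> 'b :: linorder"
  assumes "card e = 2" "card (\<alpha> ` e) = 2"
  obtains u v where "e = {u, v}" "\<alpha> u < \<alpha> v"
proof -
  obtain u v where e: "e = {u, v}" using assms(1) by (auto simp: card_2_iff)
  with assms(2) have "\<alpha> u \<noteq> \<alpha> v" by auto
  with e that[of u v] that[of v u] show thesis by (auto simp: insert_commute neq_iff)
qed

text \<open>Adding \<open>n\<close> to a colour moves it behind all unlifted colours and keeps the order among the lifted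
  ones. Write the colour pairs as \<open>a < b\<close> and \<open>c < d\<close>, with \<open>a \<le> c\<close> by symmetry. If \<open>a = c\<close> and
  \<open>b < d\<close>, then \<open>c < b < d < a + n\<close> interleave. If \<open>a < c\<close>, then \<open>a < c < b + n < d + n\<close> do when
  \<open>b < d\<close>, and \<open>a < c < b < d + n\<close> do when \<open>d \<le> b\<close>. Colours may coincide between the pairs, but the
  vertices of \<open>e\<close> and \<open>e'\<close> are distinct, so each vertex can be lifted on its own.\<close>

lemma interleaved_lift:
  fixes \<alpha> :: "'a \<Rightarrow> nat"
  assumes "card e = 2" "card e' = 2" "e \<inter> e' = {}"
    and "card (\<alpha> ` e) = 2" "card (\<alpha> ` e') = 2" "\<alpha> ` e \<noteq> \<alpha> ` e'"
    and "\<alpha> ` e \<subseteq> {..<n}" "\<alpha> ` e' \<subseteq> {..<n}"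
  shows "\<exists>g. (\<forall>v. g v \<in> {\<alpha> v, \<alpha> v + n}) \<and> interleaved (g ` e) (g ` e')"
proof -
  have lift: "\<exists>g. (\<forall>t. g t \<in> {\<alpha> t, \<alpha> t + n}) \<and> interleaved (g ` {u, v}) (g ` {x, y})"
    if d: "{u, v} \<inter> {x, y} = {}" and o: "\<alpha> u < \<alpha> v" "\<alpha> x < \<alpha> y"
      and lt: "\<alpha> v < n" "\<alpha> y < n"
      and ux: "\<alpha> u < \<alpha> x \<or> \<alpha> u = \<alpha> x \<and> \<alpha> v < \<alpha> y"
    for u v x y
  proof -
    have ne: "u \<noteq> v" "x \<noteq> y" "u \<noteq> x" "u \<noteq> y" "v \<noteq> x" "v \<noteq> y" using d o by auto
    have upper: ?thesis if "interleaved {f u, f v} {f x, f y}"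
      and "f = (\<lambda>t. if t \<in> S then \<alpha> t + n else \<alpha> t)" for f S
      using that by (intro exI[of _ f]) (simp only: image_insert image_empty, simp)
    consider "\<alpha> u = \<alpha> x" "\<alpha> v < \<alpha> y" | "\<alpha> u < \<alpha> x" "\<alpha> v < \<alpha> y" | "\<alpha> u < \<alpha> x" "\<alpha> y \<le> \<alpha> v"
      using ux by linarith
    then show ?thesis
    proof cases
      case 1
      have "interleaved {\<alpha> u + n, \<alpha> v} {\<alpha> x, \<alpha> y}"
        using interleavedI[of "\<alpha> x" "\<alpha> v" "\<alpha> y" "\<alpha> u + n"] 1 o lt
        by (auto simp: insert_commute intro: interleaved_sym)
      then show ?thesis using ne by (intro upper[OF _ refl, of "{u}"]) simp
    next
      case 2
      have "interleaved {\<alpha> u, \<alpha> v + n} {\<alpha> x, \<alpha> y + n}"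
        using interleavedI[of "\<alpha> u" "\<alpha> x" "\<alpha> v + n" "\<alpha> y + n"] 2 o lt by simp
      then show ?thesis using ne by (intro upper[OF _ refl, of "{v, y}"]) simp
    next
      case 3
      have "interleaved {\<alpha> u, \<alpha> v} {\<alpha> x, \<alpha> y + n}"
        using interleavedI[of "\<alpha> u" "\<alpha> x" "\<alpha> v" "\<alpha> y + n"] 3 o lt by simp
      then show ?thesis using ne by (intro upper[OF _ refl, of "{y}"]) simp
    qed
  qed
  obtain u v where e: "e = {u, v}" and uv: "\<alpha> u < \<alpha> v"
    using assms(1,4) by (rule card_2_image_ordered)
  obtain x y where e': "e' = {x, y}" and xy: "\<alpha> x < \<alpha> y"
    using assms(2,5) by (rule card_2_image_ordered)
  have lt: "\<alpha> v < n" "\<alpha> y < n" using assms(7,8) e e' by auto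
  have "\<alpha> u \<noteq> \<alpha> x \<or> \<alpha> v \<noteq> \<alpha> y" using assms(6) e e' by auto
  then consider "\<alpha> u < \<alpha> x \<or> \<alpha> u = \<alpha> x \<and> \<alpha> v < \<alpha> y" | "\<alpha> x < \<alpha> u \<or> \<alpha> x = \<alpha> u \<and> \<alpha> y < \<alpha> v"
    by linarith
  then show ?thesis
  proof cases
    case 1
    then show ?thesis using lift[of u v x y] assms(3) uv xy lt e e' by blast
  next
    case 2
    then have "\<exists>g. (\<forall>t. g t \<in> {\<alpha> t, \<alpha> t + n}) \<and> interleaved (g ` e') (g ` e)"
      using lift[of x y u v] assms(3) uv xy lt e e' by blast
    then show ?thesis using interleaved_sym by blast
  qed
qed

lemma glue_on_disjoint_sets:
  assumes "\<And>c d. c \<in> C \<Longrightarrow> d \<in> C \<Longrightarrow> c \<noteq> d \<Longrightarrow> S c \<inter> S d = {}"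
    and "\<And>c v. c \<in> C \<Longrightarrow> P v (g c v)" "\<And>v. P v (a v)"
  shows "\<exists>f. (\<forall>v. P v (f v)) \<and> (\<forall>c\<in>C. \<forall>v\<in>S c. f v = g c v)"
proof -
  have "\<exists>r. P v r \<and> (\<forall>c\<in>C. v \<in> S c \<longrightarrow> r = g c v)" for v
  proof (cases "\<exists>c\<in>C. v \<in> S c")
    case True
    then obtain c where c: "c \<in> C" "v \<in> S c" by blast
    then have "d = c" if "d \<in> C" "v \<in> S d" for d using assms(1)[of c d] that by blast
    then show ?thesis using assms(2)[OF c(1)] by metis
  next
    case False
    then show ?thesis using assms(3) by blast
  qed
  then show ?thesis by metis
qed

theorem theorem4:
  fixes G :: "'a geo_graph" and n :: nat
  assumes "geometric_graph G"
    and "\<And>c d. \<lbrakk>c \<in> crossings G; d \<in> crossings G; c \<noteq> d\<rbrakk> \<Longrightarrow> independent_crossings c d"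
    and "n \<ge> 1"
    and "\<exists>\<alpha>. graph_hom G (complete_graph n) \<alpha> \<and>
           (\<forall>e e'. edges_cross G e e' \<longrightarrow> \<alpha> ` e \<noteq> \<alpha> ` e')"
  shows "geochromatic_number G \<le> 2 * n"
proof -
  obtain \<alpha> where hom: "graph_hom G (complete_graph n) \<alpha>"
    and sep: "\<And>e e'. edges_cross G e e' \<Longrightarrow> \<alpha> ` e \<noteq> \<alpha> ` e'"
    using assms(4) by blast
  have edge: "e \<subseteq> verts G" "card e = 2" if "e \<in> edges G" for e
    using that assms(1) by (auto simp: geometric_graph_def simple_graph_def)
  have \<alpha>_lt: "\<alpha> v < n" if "v \<in> verts G" for v
    using hom that by (auto simp: graph_hom_def complete_graph_def)
  have \<alpha>_card: "card (\<alpha> ` e) = 2" if "e \<in> edges G" for e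
  proof -
    obtain u v where "e = {u, v}" using edge(2)[OF \<open>e \<in> edges G\<close>] by (auto simp: card_2_iff)
    then show ?thesis
      using hom that by (auto simp: graph_hom_def complete_graph_def all_pairs_def)
  qed
  have \<alpha>_sub: "\<alpha> ` e \<subseteq> {..<n}" if "e \<in> edges G" for e
    using edge(1)[OF that] \<alpha>_lt by blast
  have "\<exists>g. (\<forall>v. g v \<in> {\<alpha> v, \<alpha> v + n}) \<and>
      (\<forall>e e'. edges_cross G e e' \<and> c = {e, e'} \<longrightarrow> interleaved (g ` e) (g ` e'))"
    if c: "c \<in> crossings G" for c
  proof -
    obtain e e' where ce: "c = {e, e'}" and x: "edges_cross G e e'"
      using c by (auto simp: crossings_def)
    then have E: "e \<in> edges G" "e' \<in> edges G" "e \<inter> e' = {}" by (auto simp: edges_cross_def)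
    then obtain g where g: "\<forall>v. g v \<in> {\<alpha> v, \<alpha> v + n}" "interleaved (g ` e) (g ` e')"
      using interleaved_lift[OF edge(2)[OF E(1)] edge(2)[OF E(2)] E(3) \<alpha>_card[OF E(1)]
          \<alpha>_card[OF E(2)] sep[OF x] \<alpha>_sub[OF E(1)] \<alpha>_sub[OF E(2)]] by blast
    then show ?thesis
      unfolding ce doubleton_eq_iff by (intro exI[of _ g]) (auto intro: interleaved_sym)
  qed
  then obtain g where g: "\<And>c v. c \<in> crossings G \<Longrightarrow> g c v \<in> {\<alpha> v, \<alpha> v + n}"
    and g_cross: "\<And>c e e'. c \<in> crossings G \<Longrightarrow> edges_cross G e e' \<Longrightarrow> c = {e, e'} \<Longrightarrow>
      interleaved (g c ` e) (g c ` e')"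
    by metis
  have disjoint: "\<Union>c \<inter> \<Union>d = {}" if "c \<in> crossings G" "d \<in> crossings G" "c \<noteq> d" for c d
    using assms(2)[OF that] by (simp add: independent_crossings_def)
  have "\<exists>f. (\<forall>v. f v \<in> {\<alpha> v, \<alpha> v + n}) \<and> (\<forall>c\<in>crossings G. \<forall>v\<in>\<Union>c. f v = g c v)"
    by (rule glue_on_disjoint_sets[where a = \<alpha>]) (use disjoint g in simp_all)
  then obtain f where f: "\<forall>v. f v \<in> {\<alpha> v, \<alpha> v + n}"
    and fg_all: "\<forall>c\<in>crossings G. \<forall>v\<in>\<Union>c. f v = g c v"
    by (elim exE conjE) (rule that)
  have fg: "f v = g c v" if "c \<in> crossings G" "v \<in> \<Union>c" for c v
    using that by (rule fg_all[THEN bspec, THEN bspec])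
  have f_lt: "f v < 2 * n" if "v \<in> verts G" for v using spec[OF f, of v] \<alpha>_lt[OF that] by auto
  have "geometric_hom G (parabola_clique (2 * n)) f"
    unfolding geometric_hom_def graph_hom_def
  proof (intro conjI allI impI)
    show "f \<in> verts G \<rightarrow> verts (parabola_clique (2 * n))"
      using f_lt by (auto simp: parabola_clique_def)
    show "{f u, f v} \<in> edges (parabola_clique (2 * n))" if uv: "{u, v} \<in> edges G" for u v
    proof -
      have V: "u \<in> verts G" "v \<in> verts G" using edge[OF uv] by auto
      have "\<alpha> u \<noteq> \<alpha> v" using \<alpha>_card[OF uv] by auto
      then have "f u \<noteq> f v" using spec[OF f, of u] spec[OF f, of v] \<alpha>_lt[OF V(1)] \<alpha>_lt[OF V(2)] by auto
      then show ?thesis using f_lt V by (auto simp: parabola_clique_def all_pairs_def)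
    qed
    show "edges_cross (parabola_clique (2 * n)) (f ` e) (f ` e')" if x: "edges_cross G e e'" for e e'
    proof (rule edges_cross_parabola_clique)
      have c: "{e, e'} \<in> crossings G" using x by (auto simp: crossings_def)
      have "f ` e = g {e, e'} ` e" "f ` e' = g {e, e'} ` e'"
        using fg[OF c] by (auto intro!: image_cong)
      then show "interleaved (f ` e) (f ` e')" using g_cross[OF c x] by simp
      have "e \<in> edges G" "e' \<in> edges G" using x by (auto simp: edges_cross_def)
      then have "e \<subseteq> verts G" "e' \<subseteq> verts G" using edge(1) by simp_all
      then show "f ` e \<subseteq> {..<2 * n}" "f ` e' \<subseteq> {..<2 * n}" using f_lt by auto
    qed
  qed
  moreover have "2 * n > 0" using assms(3) by simp
  ultimately show ?thesis
    unfolding geochromatic_number_def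
    using geometric_clique_parabola_clique by (intro Least_le) blast
qed

end
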